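(* Let $m:[0,1]\to[0,1]$ be the inverse function of the Minkowski question mark function $?(x)$, and let $\widehat{m}(k)=\int_0^1 e^{2\pi i kx}\,\mathrm{d}m(x)$ be its Fourier-Stieltjes coefficients. Then, as $n\to\infty$, $$\widehat{m}(2^n)=1+O\left(\frac{1}{\log n}\right).$$
   Context: Minkowski question mark function: the continuous strictly increasing function $?:[0,1]\to[0,1]$ given, for $x$ with continued fraction expansion $x=[0;a_1,a_2,\dots]$, by $?(x)=2\sum_{n\ge1}(-1)^{n-1}2^{-(a_1+\dots+a_n)}$ (a finite sum if $x$ is rational), with $?(0)=0$, $?(1)=1$. It is a bijection of $[0,1]$, and its inverse $m$ is continuous and strictly increasing; the integral is a Riemann-Stieltjes integral. *)

theory Defs
  imports "HOL-Analysis.Analysis" "HOL-Library.Landau_Symbols"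
begin

text \<open>
  The continued fraction expansion of \<open>x \<in> [0,1]\<close> is generated by iterating the Gauss map.
  Since \<open>1 / 0 = 0\<close>, the point \<open>0\<close> is fixed; the expansion stops at the first iterate that is
  \<open>0\<close>, which happens exactly for rational \<open>x\<close>.
\<close>

definition gauss_map :: "real \<Rightarrow> real" where
  "gauss_map x = frac (1 / x)"

text \<open>
  Indices start at \<open>0\<close>: \<open>cf_digit x n\<close> is the partial quotient $a_{n+1}$ of
  $x = [0; a_1, a_2, \ldots]$, meaningful only if \<open>(gauss_map ^^ n) x \<noteq> 0\<close>.
\<close>

definition cf_digit :: "real \<Rightarrow> nat \<Rightarrow> nat" where
  "cf_digit x n = nat \<lfloor>1 / (gauss_map ^^ n) x\<rfloor>"

lemma cf_digit_step:
  assumes "0 < x" "(gauss_map ^^ n) x \<noteq> 0"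
  shows "(gauss_map ^^ n) x = 1 / (real (cf_digit x n) + (gauss_map ^^ Suc n) x)"
proof -
  have "0 \<le> (gauss_map ^^ n) x"
    using assms(1) by (cases n) (simp_all add: gauss_map_def)
  with assms(2) show ?thesis
    by (simp add: cf_digit_def gauss_map_def frac_def)
qed

text \<open>
  Of the two expansions of a rational number, the Gauss map produces the one whose last partial
  quotient is not \<open>1\<close> (except for $1 = [0; 1]$); the other one gives the same value.
  Outside \<open>[0,1]\<close> the function is irrelevant.
\<close>

definition question_mark :: "real \<Rightarrow> real" where
  "question_mark x =
     2 * (\<Sum>n. if (gauss_map ^^ n) x = 0 then 0 else (-1) ^ n / 2 ^ (\<Sum>i\<le>n. cf_digit x i))"

lemma question_mark_0: "question_mark 0 = 0"
proof -
  have "(gauss_map ^^ n) 0 = 0" for n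
    by (induction n) (simp_all add: gauss_map_def)
  then show ?thesis by (simp add: question_mark_def)
qed

lemma question_mark_1: "question_mark 1 = 1"
proof -
  have z: "(gauss_map ^^ Suc n) 1 = 0" for n
  proof (induction n)
    case (Suc n)
    have "(gauss_map ^^ Suc (Suc n)) 1 = gauss_map ((gauss_map ^^ Suc n) 1)" by simp
    also have "\<dots> = 0" unfolding Suc.IH by (simp add: gauss_map_def)
    finally show ?case .
  qed (simp add: gauss_map_def)
  have "(\<Sum>n. if (gauss_map ^^ n) 1 = 0 then 0
          else (-1) ^ n / 2 ^ (\<Sum>i\<le>n. cf_digit 1 i) :: real) =
        (\<Sum>n\<in>{0}. if (gauss_map ^^ n) 1 = 0 then 0
          else (-1) ^ n / 2 ^ (\<Sum>i\<le>n. cf_digit 1 i))"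
  proof (rule suminf_finite)
    fix n :: nat assume "n \<notin> {0}"
    then obtain k where "n = Suc k" by (cases n) auto
    then show "(if (gauss_map ^^ n) 1 = 0 then 0
          else (-1) ^ n / 2 ^ (\<Sum>i\<le>n. cf_digit 1 i) :: real) = 0"
      using z[of k] by simp
  qed simp
  then show ?thesis by (simp add: question_mark_def cf_digit_def)
qed

definition inv_question_mark :: "real \<Rightarrow> real" where
  "inv_question_mark = the_inv_into {0..1} question_mark"

text \<open>
  Riemann--Stieltjes integral of \<open>f\<close> against \<open>g\<close> over \<open>[a,b]\<close>, as a limit of sums over tagged
  partitions with mesh tending to \<open>0\<close>. A tagged division is a set of pairs \<open>(t, [u,v])\<close> of a tag
  and a subinterval, so \<open>Inf K\<close> and \<open>Sup K\<close> below are the end points of the subinterval.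
  Degenerate subintervals are allowed and contribute \<open>0\<close>.
\<close>

definition has_rs_integral ::
  "(real \<Rightarrow> 'a::real_normed_vector) \<Rightarrow> (real \<Rightarrow> real) \<Rightarrow> real \<Rightarrow> real \<Rightarrow> 'a \<Rightarrow> bool" where
  "has_rs_integral f g a b I \<longleftrightarrow>
     (\<forall>e>0. \<exists>d>0. \<forall>D. D tagged_division_of {a..b} \<and> (\<forall>(t, K)\<in>D. diameter K < d) \<longrightarrow>
        norm ((\<Sum>(t, K)\<in>D. (g (Sup K) - g (Inf K)) *\<^sub>R f t) - I) < e)"

lemma has_rs_integral_unique:
  assumes "has_rs_integral f g a b I" "has_rs_integral f g a b J"
  shows "I = J"
proof (rule ccontr)
  assume "I \<noteq> J"
  then have e: "norm (I - J) / 2 > 0" by simp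
  obtain d1 where d1: "d1 > 0"
    "\<And>D. D tagged_division_of {a..b} \<Longrightarrow> \<forall>(t, K)\<in>D. diameter K < d1 \<Longrightarrow>
        norm ((\<Sum>(t, K)\<in>D. (g (Sup K) - g (Inf K)) *\<^sub>R f t) - I) < norm (I - J) / 2"
    using assms(1) e unfolding has_rs_integral_def by meson
  obtain d2 where d2: "d2 > 0"
    "\<And>D. D tagged_division_of {a..b} \<Longrightarrow> \<forall>(t, K)\<in>D. diameter K < d2 \<Longrightarrow>
        norm ((\<Sum>(t, K)\<in>D. (g (Sup K) - g (Inf K)) *\<^sub>R f t) - J) < norm (I - J) / 2"
    using assms(2) e unfolding has_rs_integral_def by meson
  define d where "d = min d1 d2"
  have d: "d > 0" using d1 d2 by (simp add: d_def)
  have "gauge (\<lambda>x::real. ball x (d / 3))" using d by (intro gauge_ball) simp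
  then obtain D where D: "D tagged_division_of {a..b}" "(\<lambda>x. ball x (d / 3)) fine D"
    by (rule fine_division_exists_real)
  have "diameter K < d" if "(t, K) \<in> D" for t K
  proof -
    have "K \<subseteq> ball t (d / 3)" using D(2) that by (auto simp: fine_def)
    then have "diameter K \<le> diameter (ball t (d / 3))" by (intro diameter_subset) auto
    also have "\<dots> < d" using d by simp
    finally show ?thesis .
  qed
  then have "\<forall>(t, K)\<in>D. diameter K < d1" "\<forall>(t, K)\<in>D. diameter K < d2"
    by (fastforce simp: d_def)+
  note b = d1(2)[OF D(1) this(1)] d2(2)[OF D(1) this(2)]
  let ?S = "\<Sum>(t, K)\<in>D. (g (Sup K) - g (Inf K)) *\<^sub>R f t"
  have "norm (I - J) \<le> norm (?S - I) + norm (?S - J)"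
    using norm_triangle_ineq4[of "?S - J" "?S - I"] by simp
  with b show False by linarith
qed

definition rs_integral ::
  "(real \<Rightarrow> 'a::real_normed_vector) \<Rightarrow> (real \<Rightarrow> real) \<Rightarrow> real \<Rightarrow> real \<Rightarrow> 'a" where
  "rs_integral f g a b = (THE I. has_rs_integral f g a b I)"

definition m_hat :: "int \<Rightarrow> complex" where
  "m_hat k = rs_integral (\<lambda>x. exp (2 * of_real pi * \<i> * of_int k * of_real x))
     inv_question_mark 0 1"

end

theory Submission
  imports Defs
begin

text \<open>
  Substituting \<open>x = ?(y)\<close> turns the coefficient into \<open>\<integral> exp (2 \<pi> i 2^n ?(y)) dy\<close>, an
  integral against Lebesgue measure. The question mark function conjugates the Farey map
  \<open>F\<close> to the tent map, whose iterates compute the distance of \<open>2^n ?(y)\<close> to the integers. Hence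
  the integrand is within \<open>4 \<pi> F^n(y)\<close> of \<open>1\<close>, and it suffices to show that the mean of
  \<open>F^n\<close> over \<open>[0,1]\<close> is \<open>O(1 / log n)\<close>: typical orbits of \<open>F\<close> spend most of their time
  near its indifferent fixed point \<open>0\<close>.

  The map \<open>F\<close> has the infinite invariant measure \<open>dx / x\<close>. Let \<open>f\<^sub>n\<close> be the density of \<open>F^n\<close> when
  the starting point is uniform, and \<open>h\<^sub>n(x) = x f\<^sub>n(x)\<close> its density with respect to \<open>dx / x\<close>.
  The mean of \<open>F^n\<close> is \<open>\<integral> h\<^sub>n\<close>. In terms of \<open>h\<^sub>n\<close> the transfer operator is an averaging:
  \<open>h\<^sub>n\<^sub>+\<^sub>1(x) = 1/(1+x) h\<^sub>n(x/(1+x)) + x/(1+x) h\<^sub>n(1/(1+x))\<close>. It preserves the class of increasing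
  concave functions (\<open>increasing_concave_average\<close>), which contains \<open>h\<^sub>0(x) = x\<close>. So the maximum of
  \<open>h\<^sub>n\<close> is \<open>M\<^sub>n = h\<^sub>n(1)\<close>, and \<open>M\<^sub>n\<close> decreases with \<open>n\<close>.

  Two facts bound \<open>M\<^sub>n\<close>. First, \<open>f\<^sub>n\<close> has total mass \<open>1\<close> and \<open>h\<^sub>n\<close> increases, so
  \<open>h\<^sub>n(x) log (1/x) \<le> 1\<close> (\<open>farey_ratio_mass_bound\<close>). Second, unfolding the averaging \<open>k\<close> times
  from the point \<open>1\<close> along \<open>1, 1/2, 1/3, \<dots>\<close> gives
  \<open>M\<^sub>n\<^sub>+\<^sub>k \<le> h\<^sub>n(1/(k+1)) / (k+1) + k/(k+1) M\<^sub>n\<close> (\<open>farey_ratio_peak_cascade\<close>). Together they say that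
  every \<open>k\<close> steps contract the excess of \<open>M\<^sub>n\<close> over \<open>1 / log (k+1)\<close> by the factor \<open>k/(k+1)\<close>. After
  \<open>k^2\<close> such blocks, that is for \<open>n = k^3\<close>, the excess is at most \<open>1/(k+1)\<close>, and
  \<open>M\<^sub>n = O(1 / log n)\<close> follows since \<open>log n\<close> is comparable to \<open>log k\<close>.
\<close>

section \<open>The Farey map and the functional equation\<close>

definition farey :: "real \<Rightarrow> real" where
  "farey x = min x (1 - x) / max x (1 - x)"

lemma farey_left: "x \<le> 1 / 2 \<Longrightarrow> farey x = x / (1 - x)"
  and farey_right: "1 / 2 \<le> x \<Longrightarrow> farey x = (1 - x) / x"
proof -
  show "x \<le> 1 / 2 \<Longrightarrow> farey x = x / (1 - x)"
    by (simp add: farey_def min_def max_def)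
  assume x: "1 / 2 \<le> x"
  show "farey x = (1 - x) / x"
  proof (cases "x = 1 / 2")
    case True
    show ?thesis unfolding True by (simp add: farey_def)
  qed (use x in \<open>simp add: farey_def min_def max_def\<close>)
qed

lemma farey_range: "x \<in> {0..1} \<Longrightarrow> farey x \<in> {0..1}"
  by (cases "x \<le> 1 / 2") (auto simp: farey_left farey_right field_simps)

lemma continuous_on_farey: "continuous_on {0..1} farey"
  unfolding farey_def by (intro continuous_intros) (auto simp: max_def)

definition question_mark_term :: "real \<Rightarrow> nat \<Rightarrow> real" where
  "question_mark_term x n =
     (if (gauss_map ^^ n) x = 0 then 0 else (-1) ^ n / 2 ^ (\<Sum>i\<le>n. cf_digit x i))"

lemma gauss_map_iterate_range: "x \<in> {0..1} \<Longrightarrow> (gauss_map ^^ n) x \<in> {0..1}"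
  by (cases n) (auto simp: gauss_map_def frac_lt_1 less_imp_le)

lemma cf_digit_pos:
  assumes "x \<in> {0..1}" "(gauss_map ^^ n) x \<noteq> 0"
  shows "1 \<le> cf_digit x n"
proof -
  have "0 < (gauss_map ^^ n) x" "(gauss_map ^^ n) x \<le> 1"
    using gauss_map_iterate_range[OF assms(1), of n] assms(2) by auto
  then have "1 \<le> 1 / (gauss_map ^^ n) x" by simp
  then have "1 \<le> \<lfloor>1 / (gauss_map ^^ n) x\<rfloor>" by linarith
  then have "nat 1 \<le> nat \<lfloor>1 / (gauss_map ^^ n) x\<rfloor>" by (rule nat_mono)
  then show ?thesis by (simp add: cf_digit_def)
qed

lemma question_mark_term_bound:
  assumes "x \<in> {0..1}"
  shows "norm (question_mark_term x n) \<le> (1 / 2) ^ Suc n"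
proof (cases "(gauss_map ^^ n) x = 0")
  case False
  have nz: "(gauss_map ^^ i) x \<noteq> 0" if "i \<le> n" for i
  proof
    assume z: "(gauss_map ^^ i) x = 0"
    have "(gauss_map ^^ j) 0 = 0" for j
      by (induction j) (simp_all add: gauss_map_def)
    moreover have "(gauss_map ^^ n) x = (gauss_map ^^ (n - i)) ((gauss_map ^^ i) x)"
      using that by (simp flip: funpow_add[THEN fun_cong, unfolded o_def])
    ultimately show False using z False by simp
  qed
  have "(\<Sum>i\<le>n. 1) \<le> (\<Sum>i\<le>n. cf_digit x i)"
    by (rule sum_mono) (use nz cf_digit_pos[OF assms] in auto)
  then have "(2::real) ^ Suc n \<le> 2 ^ (\<Sum>i\<le>n. cf_digit x i)"
    by (intro power_increasing) auto
  then have "1 / (2::real) ^ (\<Sum>i\<le>n. cf_digit x i) \<le> 1 / 2 ^ Suc n"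
    by (intro divide_left_mono) auto
  then show ?thesis
    using False by (simp add: question_mark_term_def norm_divide norm_power power_divide)
qed (simp add: question_mark_term_def)

lemma summable_question_mark_term:
  assumes "x \<in> {0..1}"
  shows "summable (question_mark_term x)"
proof (rule summable_comparison_test)
  show "summable (\<lambda>n. (1 / 2 :: real) ^ Suc n)"
    by (subst summable_Suc_iff) (simp add: summable_geometric)
qed (use question_mark_term_bound[OF assms] in auto)

lemma question_mark_eq_suminf: "question_mark x = 2 * suminf (question_mark_term x)"
  unfolding question_mark_def by (simp flip: question_mark_term_def)

lemma question_mark_crude_bound:
  assumes "x \<in> {0..1}"
  shows "\<bar>question_mark x\<bar> \<le> 2"
proof -
  have s: "summable (\<lambda>n. (1 / 2 :: real) ^ Suc n)"
    by (subst summable_Suc_iff) (simp add: summable_geometric)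
  have sn: "summable (\<lambda>n. norm (question_mark_term x n))"
    by (rule summable_comparison_test[OF _ s]) (use question_mark_term_bound[OF assms] in auto)
  have "norm (suminf (question_mark_term x)) \<le> (\<Sum>n. norm (question_mark_term x n))"
    by (rule summable_norm[OF sn])
  also have "\<dots> \<le> (\<Sum>n. (1 / 2 :: real) ^ Suc n)"
    by (rule suminf_le[OF _ sn s]) (rule question_mark_term_bound[OF assms])
  also have "\<dots> = 1"
    using power_half_series sums_unique by metis
  finally show ?thesis by (simp add: question_mark_eq_suminf)
qed

text \<open>
  Writing \<open>x = 1 / (a + y)\<close>, the Gauss map sends \<open>x\<close> to \<open>y\<close> and shifts the partial quotients, so
  the series of \<open>y\<close> is the tail of the series of \<open>x\<close> up to the factor \<open>- (2 ^ a)\<close>.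
\<close>

lemma question_mark_first_digit:
  assumes a: "1 \<le> a" and y: "0 \<le> y" "y < 1"
  shows "question_mark (1 / (real a + y)) = (2 - question_mark y) / 2 ^ a"
proof -
  define x where "x = 1 / (real a + y)"
  have x: "x \<in> {0..1}" "x \<noteq> 0" using a y by (auto simp: x_def)
  have "\<lfloor>real a + y\<rfloor> = int a" using y by linarith
  then have g: "gauss_map x = y" and d: "cf_digit x 0 = a"
    by (auto simp: x_def gauss_map_def cf_digit_def frac_def)
  have gs: "(gauss_map ^^ Suc n) x = (gauss_map ^^ n) y" for n
    by (subst funpow_Suc_right) (simp add: g)
  have ds: "cf_digit x (Suc n) = cf_digit y n" for n
    unfolding cf_digit_def gs ..
  have t0: "question_mark_term x 0 = 1 / 2 ^ a"
    using x by (simp add: question_mark_term_def d)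
  have ts: "question_mark_term x (Suc n) = - (1 / 2 ^ a) * question_mark_term y n" for n
    unfolding question_mark_term_def gs
    by (simp add: sum.atMost_Suc_shift ds d power_add del: sum.atMost_Suc)
  have "suminf (question_mark_term x) - question_mark_term x 0 =
        (\<Sum>n. - (1 / 2 ^ a) * question_mark_term y n)"
    using suminf_split_head[OF summable_question_mark_term[OF x(1)]] by (simp add: ts)
  also have "\<dots> = - (1 / 2 ^ a) * suminf (question_mark_term y)"
    by (rule suminf_mult) (use summable_question_mark_term[of y] y in auto)
  finally have "suminf (question_mark_term x) = (1 - suminf (question_mark_term y)) / 2 ^ a"
    by (simp add: t0 diff_divide_distrib)
  then have "question_mark x = (2 - question_mark y) / 2 ^ a"
    by (simp add: question_mark_eq_suminf)
  then show ?thesis by (simp add: x_def)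
qed

lemma first_digit_cases:
  assumes "x \<in> {0<..1::real}"
  obtains a y where "1 \<le> a" "0 \<le> y" "y < 1" "x = 1 / (real a + y)"
proof
  have "1 \<le> 1 / x" using assms by simp
  then show "1 \<le> nat \<lfloor>1 / x\<rfloor>" by linarith
  show "0 \<le> frac (1 / x)" "frac (1 / x) < 1" by (auto simp: frac_lt_1)
  have "0 \<le> \<lfloor>1 / x\<rfloor>" using \<open>1 \<le> 1 / x\<close> by linarith
  then have "real (nat \<lfloor>1 / x\<rfloor>) + frac (1 / x) = 1 / x" by (simp add: frac_def)
  then show "x = 1 / (real (nat \<lfloor>1 / x\<rfloor>) + frac (1 / x))" by simp
qed

text \<open>
  Equivalently, the question mark function conjugates \<open>farey\<close> to the tent map. On the left half
  the Farey map lowers the first partial quotient by \<open>1\<close>; on the right half, where that quotient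
  is \<open>1\<close>, it agrees with the Gauss map.
\<close>

lemma question_mark_farey:
  assumes x: "x \<in> {0..1}"
  shows "question_mark x =
    (if x \<le> 1 / 2 then question_mark (farey x) / 2 else 1 - question_mark (farey x) / 2)"
proof -
  consider "x = 0" | "0 < x" "x \<le> 1 / 2" | "1 / 2 < x" using x by fastforce
  then show ?thesis
  proof cases
    case 1
    then show ?thesis by (simp add: question_mark_0 farey_left)
  next
    case 2
    obtain a y where ay: "1 \<le> a" "0 \<le> y" "y < 1" "x = 1 / (real a + y)"
      using first_digit_cases[of x] 2 by auto
    have "2 \<le> 1 / x" using 2 by (simp add: field_simps)
    then have "2 \<le> real a + y" using ay by simp
    then have a: "2 \<le> a" using ay by linarith
    then have a1: "real (a - 1) = real a - 1" by simp
    have "farey x = 1 / (real a + y) / (1 - 1 / (real a + y))"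
      using 2 ay(4) by (simp add: farey_left)
    also have "\<dots> = 1 / (real (a - 1) + y)"
      unfolding a1 using a ay(2) by (simp add: field_simps)
    finally have "farey x = 1 / (real (a - 1) + y)" .
    moreover have "(2::real) ^ a = 2 * 2 ^ (a - 1)"
      using a by (cases a) auto
    ultimately show ?thesis
      using 2 a ay question_mark_first_digit[of a y] question_mark_first_digit[of "a - 1" y]
      by simp
  next
    case 3
    have "x = 1 / (real 1 + farey x)" "0 \<le> farey x" "farey x < 1"
      using 3 x by (auto simp: farey_right field_simps)
    then show ?thesis
      using question_mark_first_digit[of 1 "farey x"] 3 by simp
  qed
qed

section \<open>The question mark function is an increasing homeomorphism\<close>

text \<open>
  Iterates of the functional equation, started at the identity. Each step halves the distance to
  the question mark function, so continuity and monotonicity pass to the limit.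
\<close>

fun question_mark_approx :: "nat \<Rightarrow> real \<Rightarrow> real" where
  "question_mark_approx 0 x = x"
| "question_mark_approx (Suc n) x =
     (if x \<le> 1 / 2 then question_mark_approx n (farey x) / 2
      else 1 - question_mark_approx n (farey x) / 2)"

lemma question_mark_approx_1: "question_mark_approx n 1 = 1"
proof -
  have "question_mark_approx n 0 = 0" for n by (induction n) (auto simp: farey_left)
  then show ?thesis by (cases n) (auto simp: farey_right)
qed

lemma question_mark_approx_error:
  "x \<in> {0..1} \<Longrightarrow> \<bar>question_mark_approx n x - question_mark x\<bar> \<le> 3 / 2 ^ n"
proof (induction n arbitrary: x)
  case 0
  then show ?case using question_mark_crude_bound[of x] by auto
next
  case (Suc n)
  then show ?case
    using Suc.IH[OF farey_range[OF Suc.prems]] question_mark_farey[OF Suc.prems]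
    by (auto simp: abs_le_iff field_simps)
qed

lemma question_mark_approx_range:
  "x \<in> {0..1} \<Longrightarrow> question_mark_approx n x \<in> {0..1}"
proof (induction n arbitrary: x)
  case (Suc n)
  then show ?case using Suc.IH[OF farey_range[OF Suc.prems]] by auto
qed auto

lemma question_mark_approx_mono:
  "\<lbrakk>0 \<le> x; x \<le> y; y \<le> 1\<rbrakk> \<Longrightarrow> question_mark_approx n x \<le> question_mark_approx n y"
proof (induction n arbitrary: x y)
  case (Suc n)
  have r: "farey x \<in> {0..1}" "farey y \<in> {0..1}"
    by (rule farey_range; use Suc.prems in simp)+
  consider "y \<le> 1 / 2" | "x \<le> 1 / 2" "1 / 2 < y" | "1 / 2 < x" by linarith
  then show ?case
  proof cases
    case 1
    then have "farey x \<le> farey y" using Suc.prems by (simp add: farey_left field_simps)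
    then show ?thesis using 1 Suc r by auto
  next
    case 2
    then show ?thesis
      using question_mark_approx_range[OF r(1), of n] question_mark_approx_range[OF r(2), of n]
      by auto
  next
    case 3
    then have "farey y \<le> farey x" using Suc.prems by (simp add: farey_right field_simps)
    then show ?thesis using 3 Suc r by auto
  qed
qed auto

lemma continuous_on_question_mark_approx: "continuous_on {0..1} (question_mark_approx n)"
proof (induction n)
  case 0
  then show ?case by (simp add: continuous_on_id)
next
  case (Suc n)
  have c: "continuous_on {0..1} (\<lambda>x. question_mark_approx n (farey x))"
    by (rule continuous_on_compose2[OF Suc continuous_on_farey]) (use farey_range in auto)
  show ?case
    unfolding question_mark_approx.simps
  proof (rule continuous_on_cases_le)
    fix x :: real assume "x \<in> {0..1}" "x = 1 / 2"
    then have "farey x = 1" by (simp add: farey_left)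
    then show "question_mark_approx n (farey x) / 2 = 1 - question_mark_approx n (farey x) / 2"
      by (simp add: question_mark_approx_1)
  qed (auto intro!: continuous_intros continuous_on_subset[OF c])
qed

lemma uniform_limit_question_mark_approx:
  "uniform_limit {0..1} question_mark_approx question_mark sequentially"
proof (rule uniform_limitI)
  fix e :: real assume "0 < e"
  have "(\<lambda>n. 3 / 2 ^ n :: real) \<longlonglongrightarrow> 0"
    using tendsto_mult_right_zero[OF LIMSEQ_realpow_zero[of "1 / 2 :: real"], of 3]
    by (simp add: power_divide)
  then have "\<forall>\<^sub>F n in sequentially. 3 / 2 ^ n < e"
    using \<open>0 < e\<close> order_tendstoD(2) by blast
  then show "\<forall>\<^sub>F n in sequentially. \<forall>x\<in>{0..1}. dist (question_mark_approx n x) (question_mark x) < e"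
    by eventually_elim
      (auto simp: dist_real_def intro: le_less_trans[OF question_mark_approx_error])
qed

lemma continuous_on_question_mark: "continuous_on {0..1} question_mark"
  by (rule uniform_limit_theorem[OF _ uniform_limit_question_mark_approx])
    (auto intro!: always_eventually continuous_on_question_mark_approx)

lemma question_mark_approx_tendsto:
  "x \<in> {0..1} \<Longrightarrow> (\<lambda>n. question_mark_approx n x) \<longlonglongrightarrow> question_mark x"
  using tendsto_uniform_limitI[OF uniform_limit_question_mark_approx] .

lemma question_mark_range: "x \<in> {0..1} \<Longrightarrow> question_mark x \<in> {0..1}"
  using LIMSEQ_le_const[OF question_mark_approx_tendsto, of x 0]
    LIMSEQ_le_const2[OF question_mark_approx_tendsto, of x 1]
    question_mark_approx_range[of x] by force

lemma question_mark_mono: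
  "\<lbrakk>0 \<le> x; x \<le> y; y \<le> 1\<rbrakk> \<Longrightarrow> question_mark x \<le> question_mark y"
  by (rule LIMSEQ_le[OF question_mark_approx_tendsto question_mark_approx_tendsto])
    (auto intro: question_mark_approx_mono)

lemma question_mark_pos:
  assumes "x \<in> {0<..1}"
  shows "0 < question_mark x"
proof -
  obtain a y where ay: "1 \<le> a" "0 \<le> y" "y < 1" "x = 1 / (real a + y)"
    using first_digit_cases[OF assms] .
  then show ?thesis
    using question_mark_first_digit[of a y] question_mark_range[of y] by auto
qed

lemma question_mark_less_1:
  assumes "0 \<le> x" "x < 1"
  shows "question_mark x < 1"
proof (cases "x \<le> 1 / 2")
  case True
  then show ?thesis
    using assms question_mark_farey[of x] question_mark_range[OF farey_range, of x] by auto
next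
  case False
  then have "0 < farey x" using assms by (simp add: farey_right)
  then show ?thesis
    using False assms question_mark_farey[of x] question_mark_pos[of "farey x"]
      farey_range[of x] by auto
qed

text \<open>
  The function is very flat at \<open>0\<close>, since \<open>2 ^ a \<ge> a + 1\<close> for the first partial quotient \<open>a\<close>.
  The linear bound allows \<open>?(F^n(y))\<close> to be replaced by \<open>F^n(y)\<close> in all later estimates.
\<close>

lemma question_mark_le:
  assumes "x \<in> {0..1}"
  shows "question_mark x \<le> 2 * x"
proof (cases "x = 0")
  case True
  then show ?thesis by (simp add: question_mark_0)
next
  case False
  obtain a y where ay: "1 \<le> a" "0 \<le> y" "y < 1" "x = 1 / (real a + y)"
    using first_digit_cases[of x] False assms by auto
  have "question_mark x \<le> 2 / 2 ^ a"
    using ay question_mark_first_digit[of a y] question_mark_range[of y]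
    by (auto intro!: divide_right_mono)
  also have "real (a + 1) \<le> 2 ^ a"
    by (metis Suc_eq_plus1 Suc_leI less_exp of_nat_le_iff of_nat_numeral of_nat_power)
  then have "2 / 2 ^ a \<le> 2 / (real a + y)"
    using ay by (intro divide_left_mono) auto
  finally show ?thesis using ay by simp
qed

text \<open>
  The branches of the Farey map do not expand uniformly, because \<open>0\<close> is an indifferent fixed
  point. Both inverse branches have derivative \<open>1 / (1 + u)^2\<close> up to sign, so among intervals
  of length \<open>d\<close> the one whose image is longest is \<open>[0,d]\<close>, with image of length \<open>d / (1 + d)\<close>.
\<close>

lemma farey_branch_contraction:
  assumes xy: "0 \<le> x" "x \<le> y" "y \<le> 1" and half: "y \<le> 1 / 2 \<or> 1 / 2 < x"
    and d: "\<bar>farey x - farey y\<bar> \<le> d"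
  shows "y - x \<le> d / (1 + d)"
proof -
  have len: "v / (1 + v) - u / (1 + u) \<le> d / (1 + d)"
    if "0 \<le> u" "u \<le> v" "v - u \<le> d" for u v :: real
  proof -
    have "v / (1 + v) - u / (1 + u) = (v - u) / ((1 + u) * (1 + v))"
      using that by (simp add: divide_simps) (simp add: algebra_simps)
    also have "\<dots> \<le> (v - u) / (1 + (v - u))"
    proof (rule divide_left_mono)
      have "0 \<le> u * (2 + v)" using that by simp
      then show "1 + (v - u) \<le> (1 + u) * (1 + v)" by (simp add: algebra_simps)
    qed (use that in auto)
    also have "\<dots> \<le> d / (1 + d)" using that by (simp add: field_simps)
    finally show ?thesis .
  qed
  show ?thesis
  proof (cases "y \<le> 1 / 2")
    case True
    define u v where "u = farey x" and "v = farey y"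
    have "x = u / (1 + u)" "y = v / (1 + v)" "0 \<le> u" "u \<le> v"
      using True xy by (auto simp: u_def v_def farey_left field_simps)
    then show ?thesis using len[of u v] d by (simp add: u_def v_def)
  next
    case False
    define u v where "u = farey y" and "v = farey x"
    have "x = 1 - v / (1 + v)" "y = 1 - u / (1 + u)" "0 \<le> u" "u \<le> v"
      using False half xy by (auto simp: u_def v_def farey_right field_simps)
    then show ?thesis using len[of u v] d by (simp add: u_def v_def)
  qed
qed

text \<open>
  The map \<open>d \<mapsto> d / (1 + d)\<close> sends \<open>1 / (n + 1)\<close> to \<open>1 / (n + 2)\<close>, so iterating the contraction
  shows that every interval of constancy is a point. An interval of constancy never crosses
  \<open>1 / 2\<close>, because the function is larger than \<open>1 / 2\<close> to the right of it.
\<close>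

lemma question_mark_fibre_length:
  "\<lbrakk>0 \<le> x; x \<le> y; y \<le> 1; question_mark x = question_mark y\<rbrakk> \<Longrightarrow> y - x \<le> 1 / (real n + 1)"
proof (induction n arbitrary: x y)
  case (Suc n)
  have r: "farey x \<in> {0..1}" "farey y \<in> {0..1}"
    by (rule farey_range; use Suc.prems in simp)+
  have half: "y \<le> 1 / 2 \<or> 1 / 2 < x"
  proof (rule ccontr)
    assume "\<not> ?thesis"
    then have h: "x \<le> 1 / 2" "1 / 2 < y" by auto
    then have "farey y < 1" by (simp add: farey_right)
    then have "question_mark (farey y) < 1" using r by (intro question_mark_less_1) auto
    then show False
      using h Suc.prems question_mark_farey[of x] question_mark_farey[of y]
        question_mark_range[OF r(1)] by auto
  qed
  then have "question_mark (farey x) = question_mark (farey y)"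
    using Suc.prems question_mark_farey[of x] question_mark_farey[of y] by (auto split: if_splits)
  then have "\<bar>farey x - farey y\<bar> \<le> 1 / (real n + 1)"
    using Suc.IH[of "farey x" "farey y"] Suc.IH[of "farey y" "farey x"] r by (auto simp: abs_if)
  then have "y - x \<le> (1 / (real n + 1)) / (1 + 1 / (real n + 1))"
    using Suc.prems half by (intro farey_branch_contraction) auto
  also have "\<dots> = 1 / (real (Suc n) + 1)" by (simp add: field_simps)
  finally show ?case .
qed auto

lemma question_mark_strict_mono: "strict_mono_on {0..1} question_mark"
proof (rule strict_mono_onI)
  fix x y :: real assume xy: "x \<in> {0..1}" "y \<in> {0..1}" "x < y"
  have "question_mark x \<noteq> question_mark y"
  proof
    assume eq: "question_mark x = question_mark y"
    obtain n where "inverse (real (Suc n)) < y - x" using reals_Archimedean xy by (meson diff_gt_0_iff_gt)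
    then show False
      using question_mark_fibre_length[of x y n] eq xy by (simp add: field_simps)
  qed
  then show "question_mark x < question_mark y" using question_mark_mono[of x y] xy by auto
qed

lemma question_mark_image: "question_mark ` {0..1} = {0..1}"
proof
  show "{0..1} \<subseteq> question_mark ` {0..1}"
  proof
    fix v :: real assume "v \<in> {0..1}"
    then show "v \<in> question_mark ` {0..1}"
      using IVT'[of question_mark 0 v 1] continuous_on_question_mark
      by (auto simp: question_mark_0 question_mark_1)
  qed
qed (use question_mark_range in auto)

section \<open>Fourier coefficients as integrals of the question mark function\<close>

lemma inv_question_mark_range: "s \<in> {0..1} \<Longrightarrow> inv_question_mark s \<in> {0..1}"
  and question_mark_inv: "s \<in> {0..1} \<Longrightarrow> question_mark (inv_question_mark s) = s"
  and inv_question_mark_question_mark: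
    "y \<in> {0..1} \<Longrightarrow> inv_question_mark (question_mark y) = y"
proof -
  have inj: "inj_on question_mark {0..1}"
    using question_mark_strict_mono by (rule strict_mono_on_imp_inj_on)
  show "s \<in> {0..1} \<Longrightarrow> inv_question_mark s \<in> {0..1}"
    unfolding inv_question_mark_def
    by (rule the_inv_into_into[OF inj _ subset_refl]) (simp add: question_mark_image)
  show "s \<in> {0..1} \<Longrightarrow> question_mark (inv_question_mark s) = s"
    unfolding inv_question_mark_def
    by (rule f_the_inv_into_f[OF inj]) (simp add: question_mark_image)
  show "y \<in> {0..1} \<Longrightarrow> inv_question_mark (question_mark y) = y"
    unfolding inv_question_mark_def by (rule the_inv_into_f_f[OF inj])
qed

lemma inv_question_mark_mono:
  assumes "0 \<le> s" "s \<le> t" "t \<le> 1"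
  shows "inv_question_mark s \<le> inv_question_mark t"
proof (rule ccontr)
  assume "\<not> ?thesis"
  then have "question_mark (inv_question_mark t) < question_mark (inv_question_mark s)"
    using assms inv_question_mark_range[of s] inv_question_mark_range[of t]
    by (intro strict_mono_onD[OF question_mark_strict_mono]) auto
  then show False using assms by (simp add: question_mark_inv)
qed

text \<open>
  Change of variables. With \<open>G(s)\<close> the integral of \<open>f \<circ> ?\<close> over \<open>[0, m(s)]\<close>, the target integral
  telescopes over any tagged division into the increments of \<open>G\<close>. Each increment differs from its
  Stieltjes term by at most the oscillation of \<open>f\<close> on the subinterval times the increment of \<open>m\<close>,
  and the increments of \<open>m\<close> sum to \<open>1\<close>.
\<close>

lemma has_rs_integral_inv_question_mark:
  fixes f :: "real \<Rightarrow> 'a::banach"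
  assumes f: "continuous_on {0..1} f"
  shows "has_rs_integral f inv_question_mark 0 1 (integral {0..1} (\<lambda>y. f (question_mark y)))"
  unfolding has_rs_integral_def
proof (intro allI impI)
  let ?m = inv_question_mark and ?q = question_mark
  fix e :: real assume e: "0 < e"
  have fq: "continuous_on {0..1} (\<lambda>y. f (?q y))"
    by (rule continuous_on_compose2[OF f continuous_on_question_mark]) (use question_mark_range in auto)
  have "uniformly_continuous_on {0..1} f"
    using f by (simp add: compact_uniformly_continuous)
  then obtain d where d: "0 < d" "\<And>s t. s \<in> {0..1} \<Longrightarrow> t \<in> {0..1} \<Longrightarrow> dist t s < d \<Longrightarrow> dist (f t) (f s) < e / 2"
    using e unfolding uniformly_continuous_on_def by (meson half_gt_zero)
  show "\<exists>d>0. \<forall>D. D tagged_division_of {0..1} \<and> (\<forall>(t, K)\<in>D. diameter K < d) \<longrightarrow>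
    norm ((\<Sum>(t, K)\<in>D. (?m (Sup K) - ?m (Inf K)) *\<^sub>R f t) - integral {0..1} (\<lambda>y. f (?q y))) < e"
  proof (rule exI[of _ d], intro conjI allI impI d(1))
    fix D :: "(real \<times> real set) set"
    assume D: "D tagged_division_of {0..1} \<and> (\<forall>(t, K)\<in>D. diameter K < d)"
    then have td: "D tagged_division_of {0..1}" by simp
    define G where "G s = integral {0..?m s} (\<lambda>y. f (?q y))" for s
    have m01: "?m 0 = 0" "?m 1 = 1"
      using inv_question_mark_question_mark[of 0] inv_question_mark_question_mark[of 1]
      by (auto simp: question_mark_0 question_mark_1)
    have "(\<Sum>(t, K)\<in>D. G (Sup K) - G (Inf K)) = G 1 - G 0"
      by (rule additive_tagged_division_1[OF _ td]) simp
    then have G: "(\<Sum>(t, K)\<in>D. G (Sup K) - G (Inf K)) = integral {0..1} (\<lambda>y. f (?q y))"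
      by (simp add: G_def m01)
    have step: "norm ((?m (Sup K) - ?m (Inf K)) *\<^sub>R f t - (G (Sup K) - G (Inf K)))
        \<le> e / 2 * (?m (Sup K) - ?m (Inf K))" if tK: "(t, K) \<in> D" for t K
    proof -
      obtain a b where K: "K = cbox a b" using tagged_division_ofD(4)[OF td tK] by blast
      have t: "t \<in> K" "K \<subseteq> {0..1}" using tagged_division_ofD(2,3)[OF td tK] by auto
      have ab: "0 \<le> a" "a \<le> b" "b \<le> 1" using t K by auto
      then have SI: "Sup K = b" "Inf K = a" using K by auto
      have m: "0 \<le> ?m a" "?m a \<le> ?m b" "?m b \<le> 1"
        using ab inv_question_mark_range[of a] inv_question_mark_range[of b]
          inv_question_mark_mono[of a b] by auto
      have c: "continuous_on {?m a..?m b} (\<lambda>y. f (?q y))"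
        by (rule continuous_on_subset[OF fq]) (use m in auto)
      have i: "(\<lambda>y. f (?q y)) integrable_on {0..?m b}"
        by (rule integrable_continuous_real[OF continuous_on_subset[OF fq]]) (use m in auto)
      have "G b - G a = integral {?m a..?m b} (\<lambda>y. f (?q y))"
        using Henstock_Kurzweil_Integration.integral_combine[OF m(1,2) i] by (simp add: G_def algebra_simps)
      then have "(?m b - ?m a) *\<^sub>R f t - (G b - G a) = integral {?m a..?m b} (\<lambda>y. f t - f (?q y))"
        using m by (subst integral_diff) (auto intro: integrable_continuous_real[OF c])
      also have "norm \<dots> \<le> e / 2 * (?m b - ?m a)"
      proof (rule integral_bound[OF m(2)])
        show "continuous_on {?m a..?m b} (\<lambda>y. f t - f (?q y))"
          by (intro continuous_intros c)
        fix y assume y: "y \<in> {?m a..?m b}"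
        have "?q (?m a) \<le> ?q y" "?q y \<le> ?q (?m b)"
          using y m by (auto intro!: question_mark_mono)
        then have "?q y \<in> K" using ab K by (simp add: question_mark_inv)
        then have "dist t (?q y) \<le> diameter K"
          using t K by (intro diameter_bounded_bound) auto
        also have "\<dots> < d" using D tK by auto
        finally have "dist (f t) (f (?q y)) < e / 2"
          using t \<open>?q y \<in> K\<close> by (intro d(2)) auto
        then show "norm (f t - f (?q y)) \<le> e / 2" by (simp add: dist_norm)
      qed
      finally show ?thesis by (simp add: SI)
    qed
    have "(\<Sum>(t, K)\<in>D. ?m (Sup K) - ?m (Inf K)) = 1"
      using additive_tagged_division_1[OF _ td, of ?m] by (simp add: m01)
    moreover have "norm (\<Sum>(t, K)\<in>D. (?m (Sup K) - ?m (Inf K)) *\<^sub>R f t - (G (Sup K) - G (Inf K)))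
        \<le> (\<Sum>(t, K)\<in>D. e / 2 * (?m (Sup K) - ?m (Inf K)))"
      by (rule sum_norm_le) (use step in auto)
    moreover have "(\<Sum>(t, K)\<in>D. (?m (Sup K) - ?m (Inf K)) *\<^sub>R f t - (G (Sup K) - G (Inf K))) =
        (\<Sum>(t, K)\<in>D. (?m (Sup K) - ?m (Inf K)) *\<^sub>R f t) - integral {0..1} (\<lambda>y. f (?q y))"
      by (simp add: G[symmetric] split_def sum_subtractf)
    moreover have "(\<Sum>(t, K)\<in>D. e / 2 * (?m (Sup K) - ?m (Inf K))) =
        e / 2 * (\<Sum>(t, K)\<in>D. ?m (Sup K) - ?m (Inf K))"
      by (simp add: split_def sum_distrib_left)
    ultimately show "norm ((\<Sum>(t, K)\<in>D. (?m (Sup K) - ?m (Inf K)) *\<^sub>R f t) -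
        integral {0..1} (\<lambda>y. f (?q y))) < e"
      using e by simp
  qed
qed

lemma m_hat_eq_integral:
  "m_hat k = integral {0..1} (\<lambda>y. exp (2 * of_real pi * \<i> * of_int k * of_real (question_mark y)))"
  unfolding m_hat_def rs_integral_def
proof (rule the_equality)
  show "has_rs_integral (\<lambda>x. exp (2 * of_real pi * \<i> * of_int k * of_real x)) inv_question_mark 0 1
    (integral {0..1} (\<lambda>y. exp (2 * of_real pi * \<i> * of_int k * of_real (question_mark y))))"
    by (rule has_rs_integral_inv_question_mark) (intro continuous_intros)
  then show "I = integral {0..1}
      (\<lambda>y. exp (2 * of_real pi * \<i> * of_int k * of_real (question_mark y)))"
    if "has_rs_integral (\<lambda>x. exp (2 * of_real pi * \<i> * of_int k * of_real x)) inv_question_mark 0 1 I"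
    for I
    using has_rs_integral_unique[OF that] by blast
qed

text \<open>
  The function \<open>\<bar>sin (\<pi> t)\<bar>\<close> has period \<open>1\<close> and is even, hence cannot tell doubling modulo \<open>1\<close>
  from the tent map; the latter becomes \<open>farey\<close> under the conjugation.
\<close>

lemma abs_sin_question_mark_iterate:
  "y \<in> {0..1} \<Longrightarrow>
    \<bar>sin (pi * (2 ^ n * question_mark y))\<bar> = \<bar>sin (pi * question_mark ((farey ^^ n) y))\<bar>"
proof (induction n arbitrary: y)
  case (Suc n)
  let ?\<theta> = "pi * (2 ^ n * question_mark (farey y))"
  have "\<bar>sin (pi * (2 ^ Suc n * question_mark y))\<bar> = \<bar>sin ?\<theta>\<bar>"
  proof (cases "y \<le> 1 / 2")
    case True
    then have "pi * (2 ^ Suc n * question_mark y) = ?\<theta>"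
      using question_mark_farey[OF Suc.prems] by simp
    then show ?thesis by (simp only:)
  next
    case False
    then have q: "question_mark y = 1 - question_mark (farey y) / 2"
      using question_mark_farey[OF Suc.prems] by simp
    have "pi * (2 ^ Suc n * question_mark y) = 2 * real (2 ^ n) * pi - ?\<theta>"
      unfolding q by (simp add: algebra_simps)
    then show ?thesis by (simp add: sin_diff del: of_nat_power)
  qed
  also have "\<dots> = \<bar>sin (pi * question_mark ((farey ^^ n) (farey y)))\<bar>"
    by (rule Suc.IH) (rule farey_range[OF Suc.prems])
  finally show ?case by (simp add: funpow_swap1)
qed simp

lemma farey_iterate_range: "y \<in> {0..1} \<Longrightarrow> (farey ^^ n) y \<in> {0..1}"
  by (induction n) (simp_all add: farey_range del: atLeastAtMost_iff)

lemma norm_exp_question_mark_le: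
  assumes y: "y \<in> {0..1}"
  shows "norm (exp (2 * of_real pi * \<i> * of_int (2 ^ n) * of_real (question_mark y)) - 1)
    \<le> 4 * pi * (farey ^^ n) y"
proof -
  let ?z = "(farey ^^ n) y"
  have z: "?z \<in> {0..1}" by (rule farey_iterate_range[OF y])
  have "2 * of_real pi * \<i> * of_int (2 ^ n) * of_real (question_mark y) =
      \<i> * of_real (2 * (pi * (2 ^ n * question_mark y)))"
    by simp
  then have "norm (exp (2 * of_real pi * \<i> * of_int (2 ^ n) * of_real (question_mark y)) - 1) =
      2 * \<bar>sin (pi * (2 ^ n * question_mark y))\<bar>"
    by (simp only: dist_exp_i_1) simp
  also have "\<dots> = 2 * \<bar>sin (pi * question_mark ?z)\<bar>"
    by (simp add: abs_sin_question_mark_iterate[OF y])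
  also have "\<dots> \<le> 2 * \<bar>pi * question_mark ?z\<bar>"
    using abs_sin_x_le_abs_x by simp
  also have "\<dots> = 2 * pi * question_mark ?z"
    using question_mark_range[OF z] by (simp add: abs_mult)
  also have "\<dots> \<le> 2 * pi * (2 * ?z)"
    by (intro mult_left_mono question_mark_le z) auto
  finally show ?thesis by simp
qed

section \<open>The transfer operator of the Farey map\<close>

text \<open>
  The Perron--Frobenius operator: it maps the density of a random point to the density of its
  image under the Farey map. The points \<open>x / (1 + x)\<close> and \<open>1 / (1 + x)\<close> are the two preimages of
  \<open>x\<close>, and \<open>1 / (1 + x)^2\<close> is the size of the derivative of both inverse branches.
\<close>

definition farey_transfer :: "(real \<Rightarrow> real) \<Rightarrow> real \<Rightarrow> real" where
  "farey_transfer w x = (w (x / (1 + x)) + w (1 / (1 + x))) / (1 + x)\<^sup>2"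

lemma continuous_on_farey_transfer:
  assumes "continuous_on {0..1} w"
  shows "continuous_on {0..1} (farey_transfer w)"
  unfolding farey_transfer_def
  by (intro continuous_intros continuous_on_compose2[OF assms]) (auto simp: field_simps)

lemma integral_farey_transfer:
  assumes \<phi>: "continuous_on {0..1} \<phi>" and w: "continuous_on {0..1} w"
  shows "integral {0..1} (\<lambda>y. \<phi> (farey y) * w y) = integral {0..1} (\<lambda>x. \<phi> x * farey_transfer w x)"
proof -
  let ?f = "\<lambda>y. \<phi> (farey y) * w y"
  have f: "continuous_on {0..1} ?f"
    by (rule continuous_on_mult[OF continuous_on_compose2[OF \<phi> continuous_on_farey] w])
      (use farey_range in auto)
  \<comment> \<open>The end points stay unevaluated so that they have the form \<open>g 0\<close>, \<open>g 1\<close> for each inverse branch \<open>g\<close>.\<close>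
  have left: "((\<lambda>x. (1 / (1 + x)\<^sup>2) *\<^sub>R ?f (x / (1 + x))) has_integral
      integral {0 / (1 + 0)..1 / (1 + 1)} ?f) {0..1}"
    by (rule has_integral_substitution[OF _ _ _ f])
      (auto intro!: derivative_eq_intros simp: field_simps power2_eq_square)
  have right: "((\<lambda>x. (- 1 / (1 + x)\<^sup>2) *\<^sub>R ?f (1 / (1 + x))) has_integral
      (integral {1 / (1 + 0)..1 / (1 + 1)} ?f - integral {1 / (1 + 1)..1 / (1 + 0)} ?f)) {0..1}"
    by (rule has_integral_substitution_general[OF finite.emptyI _ _ f])
      (auto intro!: derivative_eq_intros continuous_intros simp: field_simps power2_eq_square)
  have "integral {0..1 / 2} ?f + integral {1 / 2..1} ?f = integral {0..1} ?f"
    by (rule Henstock_Kurzweil_Integration.integral_combine)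
      (auto intro: integrable_continuous_real f)
  then have total: "((\<lambda>x. (1 / (1 + x)\<^sup>2) *\<^sub>R ?f (x / (1 + x)) -
      (- 1 / (1 + x)\<^sup>2) *\<^sub>R ?f (1 / (1 + x))) has_integral integral {0..1} ?f) {0..1}"
    using has_integral_diff[OF left right] by simp
  have density: "(1 / (1 + x)\<^sup>2) *\<^sub>R ?f (x / (1 + x)) - (- 1 / (1 + x)\<^sup>2) *\<^sub>R ?f (1 / (1 + x)) =
      \<phi> x * farey_transfer w x" if "x \<in> {0..1}" for x
  proof -
    have "farey (x / (1 + x)) = x"
      using that by (subst farey_left) (auto simp: field_simps)
    moreover have "farey (1 / (1 + x)) = x"
      using that by (subst farey_right) (auto simp: field_simps)
    ultimately show ?thesis by (simp add: farey_transfer_def algebra_simps add_divide_distrib)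
  qed
  have "((\<lambda>x. \<phi> x * farey_transfer w x) has_integral integral {0..1} ?f) {0..1}"
    by (rule has_integral_eq[OF density total])
  then show ?thesis by (simp add: integral_unique)
qed

text \<open>The density of the \<open>n\<close>-th Farey iterate of a uniformly distributed point.\<close>

definition farey_density :: "nat \<Rightarrow> real \<Rightarrow> real" where
  "farey_density n = (farey_transfer ^^ n) (\<lambda>_. 1)"

lemma farey_density_0: "farey_density 0 = (\<lambda>_. 1)"
  and farey_density_Suc: "farey_density (Suc n) = farey_transfer (farey_density n)"
  by (simp_all add: farey_density_def)

lemma continuous_on_farey_density: "continuous_on {0..1} (farey_density n)"
  by (induction n) (auto simp: farey_density_0 farey_density_Suc intro: continuous_on_farey_transfer)

lemma farey_density_nonneg: "0 \<le> x \<Longrightarrow> 0 \<le> farey_density n x"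
  by (induction n arbitrary: x) (auto simp: farey_density_0 farey_density_Suc farey_transfer_def)

lemma integral_farey_iterate:
  "continuous_on {0..1} \<phi> \<Longrightarrow>
    integral {0..1} (\<lambda>y. \<phi> ((farey ^^ n) y)) = integral {0..1} (\<lambda>x. \<phi> x * farey_density n x)"
proof (induction n arbitrary: \<phi>)
  case (Suc n)
  have "continuous_on {0..1} (\<lambda>x. \<phi> (farey x))"
    by (rule continuous_on_compose2[OF Suc.prems continuous_on_farey]) (use farey_range in auto)
  then have "integral {0..1} (\<lambda>y. \<phi> (farey ((farey ^^ n) y))) =
      integral {0..1} (\<lambda>x. \<phi> (farey x) * farey_density n x)"
    by (rule Suc.IH)
  also have "\<dots> = integral {0..1} (\<lambda>x. \<phi> x * farey_density (Suc n) x)"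
    unfolding farey_density_Suc
    by (rule integral_farey_transfer[OF Suc.prems continuous_on_farey_density])
  finally show ?case by simp
qed (simp add: farey_density_0)

lemma integral_farey_density: "integral {0..1} (farey_density n) = 1"
  using integral_farey_iterate[of "\<lambda>_. 1" n] by simp

section \<open>Monotonicity of the density relative to the invariant measure\<close>

text \<open>
  The density of the \<open>n\<close>-th iterate with respect to the infinite invariant measure \<open>dx / x\<close>.
\<close>

definition farey_ratio :: "nat \<Rightarrow> real \<Rightarrow> real" where
  "farey_ratio n x = x * farey_density n x"

lemma farey_ratio_0: "farey_ratio 0 = (\<lambda>x. x)"
  by (simp add: farey_ratio_def farey_density_0 fun_eq_iff)

text \<open>
  The two weights sum to \<open>1\<close>, which expresses the invariance of \<open>dx / x\<close>: for \<open>x \<ge> 0\<close> the new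
  value is an average of two old ones.
\<close>

lemma farey_ratio_Suc:
  "farey_ratio (Suc n) x =
    1 / (1 + x) * farey_ratio n (x / (1 + x)) + x / (1 + x) * farey_ratio n (1 / (1 + x))"
proof (cases "1 + x = 0")
  case False
  define a b where "a = farey_density n (x / (1 + x))" and "b = farey_density n (1 / (1 + x))"
  have "x * ((a + b) / (1 + x)\<^sup>2) = 1 / (1 + x) * (x / (1 + x) * a) + x / (1 + x) * (1 / (1 + x) * b)"
    by (simp add: power2_eq_square add_divide_distrib distrib_left)
  then show ?thesis
    by (simp only: farey_ratio_def farey_density_Suc farey_transfer_def a_def b_def)
qed (simp add: farey_ratio_def farey_density_Suc farey_transfer_def)

text \<open>
  The sign conditions are required on \<open>(0,1]\<close> only, whereas the derivatives exist on
  \<open>(0,\<infinity>)\<close>. Thus all derivatives are two-sided, including those at \<open>1\<close>, and the maps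
  \<open>x / (1 + x)\<close> and \<open>1 / (1 + x)\<close> keep the half-line invariant.
\<close>

definition increasing_concave :: "(real \<Rightarrow> real) \<Rightarrow> bool" where
  "increasing_concave h \<longleftrightarrow> (\<exists>h' h''.
     (\<forall>x>0. (h has_real_derivative h' x) (at x) \<and> (h' has_real_derivative h'' x) (at x)) \<and>
     (\<forall>x\<in>{0<..1}. 0 \<le> h' x \<and> h'' x \<le> 0))"

lemma increasing_concave_mono:
  assumes "increasing_concave h" "0 < x" "x \<le> y" "y \<le> 1"
  shows "h x \<le> h y"
proof -
  obtain h' h'' where h: "\<forall>x>0. (h has_real_derivative h' x) (at x) \<and> (h' has_real_derivative h'' x) (at x)"
    "\<forall>x\<in>{0<..1}. 0 \<le> h' x \<and> h'' x \<le> 0"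
    using assms(1) by (auto simp: increasing_concave_def)
  show ?thesis
  proof (rule DERIV_nonneg_imp_nondecreasing[OF assms(3)])
    fix t assume "x \<le> t" "t \<le> y"
    then show "\<exists>y. (h has_real_derivative y) (at t) \<and> 0 \<le> y"
      using h assms by (intro exI[of _ "h' t"]) auto
  qed
qed

text \<open>
  Monotonicity alone is not obviously preserved: as \<open>x\<close> grows, the second argument \<open>V = 1 / (1 + x)\<close>
  moves down. Concavity compensates, because \<open>U = x / (1 + x)\<close> lies below \<open>V\<close> on \<open>(0,1]\<close>. The
  derivative of the average is \<open>V^2 P\<close> with \<open>P = (h(V) - h(U)) + (V h'(U) - U h'(V))\<close>; the first
  bracket is nonnegative because \<open>h\<close> increases, and the second one because \<open>h'\<close> decreases and
  \<open>U \<le> V\<close>. Differentiating once more, with \<open>P' = V^2 Q\<close>, produces only nonpositive terms.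
\<close>

lemma increasing_concave_average:
  assumes "increasing_concave h"
  shows "increasing_concave (\<lambda>x. 1 / (1 + x) * h (x / (1 + x)) + x / (1 + x) * h (1 / (1 + x)))"
proof -
  obtain h' h'' where
    hd: "\<forall>x>0. (h has_real_derivative h' x) (at x) \<and> (h' has_real_derivative h'' x) (at x)"
    and hs: "\<forall>x\<in>{0<..1}. 0 \<le> h' x \<and> h'' x \<le> 0"
    using assms by (auto simp: increasing_concave_def)
  have h: "(h has_real_derivative h' x) (at x)" "(h' has_real_derivative h'' x) (at x)"
    if "0 < x" for x using hd that by auto
  have sgn: "0 \<le> h' x" "h'' x \<le> 0" if "0 < x" "x \<le> 1" for x using hs that by auto
  define U V :: "real \<Rightarrow> real" where "U = (\<lambda>x. x / (1 + x))" and "V = (\<lambda>x. 1 / (1 + x))"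
  define P where "P x = h (V x) - h (U x) + V x * h' (U x) - U x * h' (V x)" for x
  define Q where "Q x = V x * h'' (U x) + U x * h'' (V x) - 2 * h' (U x) - 2 * h' (V x)" for x
  have dU: "(U has_real_derivative (V x)\<^sup>2) (at x)" and dV: "(V has_real_derivative - (V x)\<^sup>2) (at x)"
    and pos: "0 < U x" "0 < V x" if "0 < x" for x
    using that unfolding U_def V_def
    by (auto intro!: derivative_eq_intros simp: field_simps power2_eq_square)
  have dG: "((\<lambda>x. V x * h (U x) + U x * h (V x)) has_real_derivative (V x)\<^sup>2 * P x) (at x)"
    if x: "0 < x" for x
  proof -
    note hU = DERIV_chain2[OF h(1)[OF pos(1)[OF x]] dU[OF x]]
      and hV = DERIV_chain2[OF h(1)[OF pos(2)[OF x]] dV[OF x]]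
    show ?thesis
      by (rule DERIV_cong[OF DERIV_add[OF DERIV_mult[OF dV[OF x] hU] DERIV_mult[OF dU[OF x] hV]]])
        (simp add: P_def algebra_simps power2_eq_square)
  qed
  have dP: "(P has_real_derivative (V x)\<^sup>2 * Q x) (at x)" if x: "0 < x" for x
  proof -
    note hU = DERIV_chain2[OF h(1)[OF pos(1)[OF x]] dU[OF x]]
      and hV = DERIV_chain2[OF h(1)[OF pos(2)[OF x]] dV[OF x]]
      and h'U = DERIV_chain2[OF h(2)[OF pos(1)[OF x]] dU[OF x]]
      and h'V = DERIV_chain2[OF h(2)[OF pos(2)[OF x]] dV[OF x]]
    show ?thesis unfolding P_def
      by (rule DERIV_cong[OF DERIV_diff[OF DERIV_add[OF DERIV_diff[OF hV hU]
            DERIV_mult[OF dV[OF x] h'U]] DERIV_mult[OF dU[OF x] h'V]]])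
        (simp add: Q_def algebra_simps power2_eq_square)
  qed
  have dG': "((\<lambda>x. (V x)\<^sup>2 * P x) has_real_derivative (V x) ^ 4 * Q x - 2 * (V x) ^ 3 * P x) (at x)"
    if x: "0 < x" for x
    unfolding power2_eq_square
    by (rule DERIV_cong[OF DERIV_mult[OF DERIV_mult[OF dV[OF x] dV[OF x]] dP[OF x]]])
      (simp add: algebra_simps eval_nat_numeral)
  have P: "0 \<le> P x" and Q: "Q x \<le> 0" if x: "0 < x" "x \<le> 1" for x
  proof -
    have UV: "0 < U x" "U x \<le> V x" "V x \<le> 1"
      using x by (auto simp: U_def V_def divide_right_mono)
    have "h (U x) \<le> h (V x)"
      by (rule increasing_concave_mono[OF assms UV])
    moreover have "h' (V x) \<le> h' (U x)"
    proof (rule DERIV_nonpos_imp_nonincreasing[OF UV(2)])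
      fix t assume "U x \<le> t" "t \<le> V x"
      then show "\<exists>y. (h' has_real_derivative y) (at t) \<and> y \<le> 0"
        using UV by (intro exI[of _ "h'' t"]) (auto intro!: h sgn)
    qed
    then have "U x * h' (V x) \<le> V x * h' (U x)"
      using UV sgn(1)[of "V x"] by (intro mult_mono) auto
    ultimately show "0 \<le> P x" by (simp add: P_def)
    have "V x * h'' (U x) \<le> 0" "U x * h'' (V x) \<le> 0" "0 \<le> h' (U x)" "0 \<le> h' (V x)"
      using UV by (auto intro!: mult_nonneg_nonpos sgn)
    then show "Q x \<le> 0" by (simp add: Q_def)
  qed
  have "increasing_concave (\<lambda>x. V x * h (U x) + U x * h (V x))"
    unfolding increasing_concave_def
  proof (intro exI conjI allI ballI impI)
    fix x :: real assume "0 < x"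
    then show "((\<lambda>x. V x * h (U x) + U x * h (V x)) has_real_derivative (V x)\<^sup>2 * P x) (at x)"
      "((\<lambda>x. (V x)\<^sup>2 * P x) has_real_derivative (V x) ^ 4 * Q x - 2 * (V x) ^ 3 * P x) (at x)"
      by (rule dG, rule dG')
  next
    fix x :: real assume "x \<in> {0<..1}"
    then have x: "0 < x" "x \<le> 1" by auto
    show "0 \<le> (V x)\<^sup>2 * P x" using P[OF x] by simp
    have "(V x) ^ 4 * Q x \<le> 0" "0 \<le> 2 * (V x) ^ 3 * P x"
      using P[OF x] Q[OF x] pos[OF x(1)] by (auto intro!: mult_nonneg_nonpos)
    then show "(V x) ^ 4 * Q x - 2 * (V x) ^ 3 * P x \<le> 0" by linarith
  qed
  then show ?thesis by (simp add: U_def V_def)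
qed

lemma increasing_concave_farey_ratio: "increasing_concave (farey_ratio n)"
proof (induction n)
  case 0
  show ?case
    unfolding farey_ratio_0 increasing_concave_def
    by (rule exI[of _ "\<lambda>_. 1"], rule exI[of _ "\<lambda>_. 0"]) (auto intro!: derivative_eq_intros)
next
  case (Suc n)
  then show ?case
    using increasing_concave_average[OF Suc] by (simp add: farey_ratio_Suc[abs_def])
qed

lemma farey_ratio_mono:
  "\<lbrakk>0 < x; x \<le> y; y \<le> 1\<rbrakk> \<Longrightarrow> farey_ratio n x \<le> farey_ratio n y"
  by (rule increasing_concave_mono[OF increasing_concave_farey_ratio])

section \<open>Logarithmic decay\<close>

lemma farey_ratio_peak_antimono:
  assumes "n \<le> n'"
  shows "farey_ratio n' 1 \<le> farey_ratio n 1"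
  using assms
proof (induction rule: dec_induct)
  case (step i)
  have "farey_ratio (Suc i) 1 \<le> farey_ratio i 1"
    by (simp add: farey_ratio_Suc farey_ratio_mono)
  with step.IH show ?case by linarith
qed simp

lemma farey_ratio_nonneg: "0 \<le> x \<Longrightarrow> 0 \<le> farey_ratio n x"
  by (simp add: farey_ratio_def farey_density_nonneg)

text \<open>
  By monotonicity the density is at least \<open>farey_ratio n x / t\<close> at every \<open>t \<in> [x,1]\<close>, and its
  integral is \<open>1\<close>.
\<close>

lemma farey_ratio_mass_bound:
  assumes x: "0 < x" "x \<le> 1"
  shows "farey_ratio n x * ln (1 / x) \<le> 1"
proof -
  have c: "continuous_on {x..1} (farey_density n)"
    by (rule continuous_on_subset[OF continuous_on_farey_density]) (use x in auto)
  have "((\<lambda>t. 1 / t) has_integral (ln 1 - ln x)) {x..1}"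
    using x by (intro fundamental_theorem_of_calculus)
      (auto intro!: derivative_eq_intros simp flip: has_real_derivative_iff_has_vector_derivative)
  then have "((\<lambda>t. farey_ratio n x * (1 / t)) has_integral (farey_ratio n x * (ln 1 - ln x))) {x..1}"
    by (rule has_integral_mult_right)
  moreover have "(farey_density n has_integral integral {x..1} (farey_density n)) {x..1}"
    using integrable_continuous_real[OF c] by (rule integrable_integral)
  ultimately have "farey_ratio n x * (ln 1 - ln x) \<le> integral {x..1} (farey_density n)"
  proof (rule has_integral_le)
    fix t assume t: "t \<in> {x..1}"
    then have "farey_ratio n x \<le> farey_ratio n t" using x by (intro farey_ratio_mono) auto
    then show "farey_ratio n x * (1 / t) \<le> farey_density n t"
      using t x by (simp add: farey_ratio_def[of n t] field_simps)
  qed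
  also have "\<dots> \<le> integral {0..1} (farey_density n)"
    using x by (intro integral_subset_le integrable_continuous_real c continuous_on_farey_density)
      (auto intro: farey_density_nonneg)
  finally show ?thesis using x by (simp add: integral_farey_density ln_div)
qed

text \<open>
  The averaging expresses the value at \<open>1 / (k + 1)\<close> through the values at \<open>1 / (k + 2)\<close> and
  \<open>(k + 1) / (k + 2)\<close>. Following the first and bounding the second by the maximum, the weight
  that remains after \<open>k\<close> steps from \<open>1\<close> is \<open>1/2 \<cdot> 2/3 \<cdots> k/(k+1) = 1/(k+1)\<close>. In other words, a
  high peak at time \<open>n + k\<close> forces a high value near \<open>0\<close> at time \<open>n\<close>, which the mass bound limits.
\<close>

lemma farey_ratio_peak_cascade:
  "farey_ratio (n + k) 1 \<le>
    farey_ratio n (1 / (real k + 1)) / (real k + 1) + real k / (real k + 1) * farey_ratio n 1"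
proof (induction k arbitrary: n)
  case (Suc k)
  let ?M = "farey_ratio n 1" and ?a = "farey_ratio n (1 / (real k + 2))"
  have s: "1 / (real k + 1) / (1 + 1 / (real k + 1)) = 1 / (real k + 2)"
    "1 / (1 + 1 / (real k + 1)) = (real k + 1) / (real k + 2)"
    by (simp_all add: field_simps)
  have "farey_ratio (Suc n) (1 / (real k + 1)) =
      (real k + 1) / (real k + 2) * ?a + 1 / (real k + 2) * farey_ratio n ((real k + 1) / (real k + 2))"
    by (simp only: farey_ratio_Suc s)
  also have "\<dots> \<le> (real k + 1) / (real k + 2) * ?a + 1 / (real k + 2) * ?M"
    by (intro add_left_mono mult_left_mono farey_ratio_mono) auto
  finally have 1: "farey_ratio (Suc n) (1 / (real k + 1)) / (real k + 1) \<le>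
      ((real k + 1) / (real k + 2) * ?a + 1 / (real k + 2) * ?M) / (real k + 1)"
    by (intro divide_right_mono) auto
  have 2: "real k / (real k + 1) * farey_ratio (Suc n) 1 \<le> real k / (real k + 1) * ?M"
    by (intro mult_left_mono farey_ratio_peak_antimono) auto
  have "farey_ratio (n + Suc k) 1 \<le>
      ((real k + 1) / (real k + 2) * ?a + 1 / (real k + 2) * ?M) / (real k + 1) + real k / (real k + 1) * ?M"
    using Suc.IH[of "Suc n"] 1 2 by simp
  also have "\<dots> = ?a / (real k + 2) + (real k + 1) / (real k + 2) * ?M"
  proof -
    have "real k + 1 \<noteq> 0" "real k + 2 \<noteq> 0" by linarith+
    then show ?thesis by (simp add: divide_simps) (simp add: algebra_simps)
  qed
  finally show ?case by (simp add: add.commute add.left_commute)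
qed simp

text \<open>
  With the mass bound, the cascade becomes the affine recursion
  \<open>M \<mapsto> 1 / ((k + 1) log (k + 1)) + k / (k + 1) M\<close>, whose fixed point is \<open>1 / log (k + 1)\<close>.
\<close>

lemma farey_ratio_peak_block:
  assumes "1 \<le> k"
  shows "farey_ratio (j * k) 1 \<le> 1 / ln (real k + 1) + (real k / (real k + 1)) ^ j"
proof (induction j)
  case 0
  have "0 \<le> 1 / ln (real k + 1)" by simp
  then show ?case by (simp add: farey_ratio_0)
next
  case (Suc j)
  let ?L = "ln (real k + 1)" and ?r = "real k / (real k + 1)"
  have L: "0 < ?L" using assms by simp
  have "farey_ratio (j * k) (1 / (real k + 1)) \<le> 1 / ?L"
    using farey_ratio_mass_bound[of "1 / (real k + 1)" "j * k"] L by (simp add: field_simps)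
  then have "farey_ratio (j * k) (1 / (real k + 1)) / (real k + 1) \<le> 1 / ?L / (real k + 1)"
    by (intro divide_right_mono) auto
  moreover have "?r * farey_ratio (j * k) 1 \<le> ?r * (1 / ?L + ?r ^ j)"
    by (intro mult_left_mono Suc.IH) auto
  moreover have "1 / ?L / (real k + 1) + ?r * (1 / ?L + ?r ^ j) = 1 / ?L + ?r ^ Suc j"
  proof -
    have "1 / (real k + 1) + ?r = 1" by (simp add: field_simps)
    then have "1 / ?L * (1 / (real k + 1) + ?r) = 1 / ?L" by simp
    then show ?thesis by (simp add: algebra_simps)
  qed
  ultimately show ?case
    using farey_ratio_peak_cascade[of "j * k" k] by (simp add: add.commute)
qed

lemma ex_cube_bracket: "\<exists>k. k ^ 3 \<le> n \<and> n < (k + 1 :: nat) ^ 3"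
proof (induction n)
  case (Suc n)
  then obtain k where k: "k ^ 3 \<le> n" "n < (k + 1) ^ 3" by blast
  show ?case
  proof (cases "Suc n < (k + 1) ^ 3")
    case False
    then have "Suc n = (k + 1) ^ 3" using k by simp
    then show ?thesis by (intro exI[of _ "k + 1"]) (auto intro: power_strict_mono)
  qed (use k in \<open>intro exI[of _ k]; simp\<close>)
qed auto

text \<open>
  Take \<open>k\<close> to be the integer part of the cube root of \<open>n\<close> and use \<open>k * k\<close> blocks of length \<open>k\<close>: by
  Bernoulli's inequality the geometric term is then at most \<open>1 / (k + 1)\<close>.
\<close>

lemma farey_ratio_peak_decay:
  assumes n: "2 \<le> n"
  shows "farey_ratio n 1 \<le> 6 / ln (real n)"
proof -
  obtain k where k: "k ^ 3 \<le> n" "n < (k + 1) ^ 3" using ex_cube_bracket by blast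
  have k1: "1 \<le> k" using k n by (cases k) auto
  let ?L = "ln (real k + 1)"
  have L: "0 < ?L" using k1 by simp
  have "1 + real k \<le> (1 + 1 / real k) ^ (k * k)"
    using Bernoulli_inequality[of "1 / real k" "k * k"] k1
    by (simp add: order_trans[OF _ divide_nonneg_nonneg])
  moreover have "(real k / (real k + 1)) ^ (k * k) = 1 / (1 + 1 / real k) ^ (k * k)"
    using k1 by (simp flip: power_one_over add: field_simps)
  ultimately have "(real k / (real k + 1)) ^ (k * k) \<le> 1 / (1 + real k)"
    by (simp add: frac_le)
  also have "\<dots> \<le> 1 / ?L"
    using L ln_le_minus_one[of "real k + 1"] by (intro divide_left_mono) auto
  finally have r: "(real k / (real k + 1)) ^ (k * k) \<le> 1 / ?L" .
  have "farey_ratio n 1 \<le> farey_ratio (k * k * k) 1"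
    using k by (intro farey_ratio_peak_antimono) (simp add: power3_eq_cube)
  also have "\<dots> \<le> 1 / ?L + (real k / (real k + 1)) ^ (k * k)"
    by (rule farey_ratio_peak_block[OF k1])
  also have "\<dots> \<le> 2 / ?L" using r by simp
  also have "\<dots> \<le> 6 / ln (real n)"
  proof -
    have "real n \<le> (real k + 1) ^ 3"
      using k(2) by (metis less_imp_le of_nat_1 of_nat_add of_nat_le_iff of_nat_power)
    then have "ln (real n) \<le> ln ((real k + 1) ^ 3)" using n by (intro ln_mono) auto
    also have "\<dots> = 3 * ?L" using k1 by (subst ln_realpow) auto
    finally show ?thesis using n L by (simp add: field_simps)
  qed
  finally show ?thesis .
qed

lemma norm_m_hat_minus_1_le: "norm (m_hat (2 ^ n) - 1) \<le> 4 * pi * farey_ratio n 1"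
proof -
  let ?e = "\<lambda>y. exp (2 * of_real pi * \<i> * of_int (2 ^ n) * of_real (question_mark y)) :: complex"
  have e: "?e integrable_on {0..1}"
    by (intro integrable_continuous_real continuous_intros continuous_on_question_mark)
  have "norm (integral {0..1} (farey_ratio n)) \<le> farey_ratio n 1 * (1 - 0)"
  proof (rule integral_bound)
    show "continuous_on {0..1} (farey_ratio n)"
      unfolding farey_ratio_def[abs_def] by (intro continuous_intros continuous_on_farey_density)
    fix x :: real assume "x \<in> {0..1}"
    then show "norm (farey_ratio n x) \<le> farey_ratio n 1"
      using farey_ratio_nonneg[of x n] farey_ratio_nonneg[of 1 n] farey_ratio_mono[of x 1 n]
      by (cases "x = 0") (auto simp: farey_ratio_def[of n 0])
  qed simp
  then have peak: "integral {0..1} (farey_ratio n) \<le> farey_ratio n 1" by simp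
  have fc: "continuous_on {0..1} (farey ^^ n)"
    by (induction n)
      (auto intro!: continuous_on_compose2[OF continuous_on_farey] continuous_on_id
        simp: o_def dest: farey_iterate_range)
  have "m_hat (2 ^ n) - 1 = integral {0..1} (\<lambda>y. ?e y - 1)"
    using e by (subst integral_diff) (auto simp: m_hat_eq_integral)
  also have "norm \<dots> \<le> integral {0..1} (\<lambda>y. 4 * pi * (farey ^^ n) y)"
    by (intro integral_norm_bound_integral integrable_diff e norm_exp_question_mark_le
        integrable_continuous_real continuous_intros fc) auto
  also have "\<dots> = 4 * pi * integral {0..1} (farey_ratio n)"
    using integral_farey_iterate[OF continuous_on_id, of n] by (simp add: farey_ratio_def[abs_def])
  also have "\<dots> \<le> 4 * pi * farey_ratio n 1"
    using peak by simp
  finally show ?thesis .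
qed

theorem theorem3:
  "(\<lambda>n::nat. m_hat (2 ^ n) - 1) \<in> O(\<lambda>n. complex_of_real (1 / ln (real n)))"
proof (rule bigoI)
  show "\<forall>\<^sub>F n in sequentially.
      norm (m_hat (2 ^ n) - 1) \<le> 24 * pi * norm (complex_of_real (1 / ln (real n)))"
    using eventually_ge_at_top[of 2]
  proof eventually_elim
    case (elim n)
    have "norm (m_hat (2 ^ n) - 1) \<le> 4 * pi * (6 / ln (real n))"
      using norm_m_hat_minus_1_le[of n] mult_left_mono[OF farey_ratio_peak_decay[OF elim], of "4 * pi"]
      by simp
    also have "\<dots> = 24 * pi * norm (complex_of_real (1 / ln (real n)))"
      using elim by (simp only: norm_of_real) simp
    finally show ?case .
  qed
qed

end
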